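(* Let $n\ge 2$, and let $p$ be a $\boldsymbol{1}$-central hyperbolic polynomial of degree $m$ on $\mathbb{R}^n$ with Gårding cone $\Gamma(p)_+$. If $\Gamma(p)_+ \supset \Gamma(\sigma_2)_+$, then \[p(a)^{\frac{1}{m}} \geq p(\boldsymbol{1})^{\frac{1}{m}} \left(\frac{\sigma_2(a)}{\binom{n}{2}}\right)^{\frac{1}{2}} \quad \text{for every } a \in \Gamma(\sigma_2)_+.\]
   Context: $\boldsymbol{1}=(1,\dots,1)\in\mathbb{R}^n$, and $\sigma_2(x)=\sum_{i<j}x_ix_j$ for $x\in\mathbb{R}^n$. A homogeneous polynomial $p$ of degree $m$ (with $m \ge 1$) on a finite-dimensional real vector space $V$ is hyperbolic with respect to $a\in V$ ($a$-hyperbolic) if $p(a)>0$ and for every $x\in V$ the polynomial $s\mapsto p(sa+x)$ has only real roots; then $p(sa+x)=p(a)\prod_{j=1}^m(s+\lambda_j^{p,a}(x))$ with real $\lambda_j^{p,a}(x)$. Its Gårding cone is $\Gamma(p)_+=\{x:\lambda^{p,a}_j(x)>0\ \forall j\}$, equivalently the connected component of $\{p>0\}$ containing $a$; by Gårding's theorem $p$ is $b$-hyperbolic with the same Gårding cone for every $b\in\Gamma(p)_+$. Set $\operatorname{tr}^{p,a}(x)=\sum_{j=1}^m\lambda_j^{p,a}(x)$. A polynomial $p$ of degree $m$ on $\mathbb{R}^n$ that is $\boldsymbol{1}$-hyperbolic is $\boldsymbol{1}$-central if there is a constant $\kappa>0$ with $\operatorname{tr}^{p,\boldsymbol{1}}(x)=\kappa(x_1+\dots+x_n)$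 for all $x\in\mathbb{R}^n$ (necessarily $\kappa=m/n$). The polynomial $\sigma_2$ is $\boldsymbol{1}$-hyperbolic; $\Gamma(\sigma_2)_+$ denotes its Gårding cone (with respect to $\boldsymbol{1}$), which equals $\{x:x_1+\dots+x_n>0,\ \sigma_2(x)>0\}$. *)

theory Defs
  imports "HOL-Analysis.Analysis" "HOL-Computational_Algebra.Computational_Algebra"
begin

text \<open>
  Over the infinite field \<open>\<real>\<close> a polynomial on a finite-dimensional space is the same thing as a
  polynomial function. The zero function is homogeneous of every degree.
\<close>

definition homogeneous_polynomial :: "nat \<Rightarrow> ('a::euclidean_space \<Rightarrow> real) \<Rightarrow> bool" where
  "homogeneous_polynomial m p \<longleftrightarrow>
     real_polynomial_function p \<and> (\<forall>t x. p (t *\<^sub>R x) = t ^ m * p x)"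

definition line_poly :: "('a::euclidean_space \<Rightarrow> real) \<Rightarrow> 'a \<Rightarrow> 'a \<Rightarrow> real poly" where
  "line_poly p a x = (THE q. \<forall>s. poly q s = p (s *\<^sub>R a + x))"

lemma line_poly_unique: "\<exists>!q. \<forall>s. poly q s = p (s *\<^sub>R a + x)"
  if "real_polynomial_function p" for p :: "'a::euclidean_space \<Rightarrow> real"
proof (rule ex_ex1I)
  show "\<exists>q. \<forall>s. poly q s = p (s *\<^sub>R a + x)"
    using that
  proof induction
    case (linear f)
    then interpret bounded_linear f .
    show ?case by (rule exI[of _ "[:f x, f a:]"]) (simp add: add scaleR)
  next
    case (const c)
    show ?case by (rule exI[of _ "[:c:]"]) simp
  next
    case (add f g)
    then show ?case by (metis poly_add)
  next
    case (mult f g)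
    then show ?case by (metis poly_mult)
  qed
next
  fix q r assume "\<forall>s. poly q s = p (s *\<^sub>R a + x)" "\<forall>s. poly r s = p (s *\<^sub>R a + x)"
  then show "q = r" by (simp add: poly_eq_poly_eq_iff[symmetric] fun_eq_iff)
qed

lemma poly_line_poly: "poly (line_poly p a x) s = p (s *\<^sub>R a + x)"
  if "real_polynomial_function p"
  using theI'[OF line_poly_unique[OF that], of a x] by (simp add: line_poly_def)

text \<open>``Only real roots'' means that every complex root is real.\<close>

definition hyperbolic ::
    "nat \<Rightarrow> ('a::euclidean_space \<Rightarrow> real) \<Rightarrow> 'a \<Rightarrow> bool" where
  "hyperbolic m p a \<longleftrightarrow>
     m \<ge> 1 \<and> homogeneous_polynomial m p \<and> p a > 0 \<and>
     (\<forall>x. \<forall>z::complex. poly (map_poly of_real (line_poly p a x)) z = 0 \<longrightarrow> z \<in> \<real>)"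

text \<open>
  The eigenvalues of \<open>x\<close> are the negatives of the roots of \<open>s \<mapsto> p (s a + x)\<close>, with multiplicity;
  see \<open>hyperbolic_factorization\<close> below.
\<close>

definition eigenvalues :: "('a::euclidean_space \<Rightarrow> real) \<Rightarrow> 'a \<Rightarrow> 'a \<Rightarrow> real multiset" where
  "eigenvalues p a x = image_mset uminus (proots (line_poly p a x))"

definition garding_cone :: "('a::euclidean_space \<Rightarrow> real) \<Rightarrow> 'a \<Rightarrow> 'a set" where
  "garding_cone p a = {x. \<forall>l \<in># eigenvalues p a x. l > 0}"

definition hyp_trace :: "('a::euclidean_space \<Rightarrow> real) \<Rightarrow> 'a \<Rightarrow> 'a \<Rightarrow> real" where
  "hyp_trace p a x = sum_mset (eigenvalues p a x)"

text \<open>On \<open>\<real>\<^sup>n\<close> the constant \<open>1\<close> is the vector \<open>(1, \<dots>, 1)\<close>.\<close>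

definition central_hyperbolic :: "nat \<Rightarrow> (real ^ 'n \<Rightarrow> real) \<Rightarrow> bool" where
  "central_hyperbolic m p \<longleftrightarrow>
     hyperbolic m p 1 \<and> (\<exists>\<kappa>>0. \<forall>x. hyp_trace p 1 x = \<kappa> * (\<Sum>i\<in>UNIV. x $ i))"

text \<open>
  The index type carries no order, so the sum over pairs \<open>i < j\<close> is written as a sum over
  two-element index sets.
\<close>

definition sigma2 :: "real ^ 'n \<Rightarrow> real" where
  "sigma2 x = (\<Sum>S | S \<subseteq> UNIV \<and> card S = 2. \<Prod>i\<in>S. x $ i)"

lemma sigma2_linorder:
  fixes x :: "real ^ ('n::{finite,linorder})"
  shows "sigma2 x = (\<Sum>(i,j) | i < j. x $ i * x $ j)"
proof -
  have *: "bij_betw (\<lambda>(i,j). {i,j}) {(i,j). i < j} {S::'n set. S \<subseteq> UNIV \<and> card S = 2}"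
    unfolding bij_betw_def
  proof
    show "inj_on (\<lambda>(i,j). {i,j}) {(i::'n,j). i < j}"
      by (auto simp: inj_on_def doubleton_eq_iff)
    show "(\<lambda>(i,j). {i,j}) ` {(i::'n,j). i < j} = {S. S \<subseteq> UNIV \<and> card S = 2}"
      by (auto simp: card_2_iff image_iff) (metis insert_commute linorder_neqE)
  qed
  show ?thesis
    unfolding sigma2_def sum.reindex_bij_betw[OF *, symmetric]
    by (rule sum.cong) auto
qed

lemma map_poly_of_real_mult:
  fixes q r :: "real poly"
  shows "map_poly complex_of_real (q * r) = map_poly of_real q * map_poly of_real r"
  by (rule poly_eqI) (simp add: coeff_map_poly coeff_mult)

lemma poly_map_poly_of_real:
  fixes q :: "real poly"
  shows "poly (map_poly complex_of_real q) (of_real r) = of_real (poly q r)"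
  by (induction q) (simp_all add: map_poly_pCons)

lemma real_rooted_factorization:
  fixes q :: "real poly"
  assumes "q \<noteq> 0" "\<And>z::complex. poly (map_poly of_real q) z = 0 \<Longrightarrow> z \<in> \<real>"
  shows "q = smult (lead_coeff q) (\<Prod>r\<in>#proots q. [:-r, 1:])"
  using assms
proof (induction "degree q" arbitrary: q)
  case 0
  then obtain c where "q = [:c:]" by (metis degree_eq_zeroE)
  then show ?case by simp
next
  case (Suc d)
  have "degree (map_poly complex_of_real q) = Suc d"
    using Suc.hyps(2) by (simp add: degree_map_poly)
  then obtain z :: complex where z: "poly (map_poly of_real q) z = 0"
    using fundamental_theorem_of_algebra[of "map_poly complex_of_real q"]
    by (metis constant_degree nat.distinct(1))
  then obtain r :: real where r: "z = of_real r"
    using Suc.prems(2) by (blast elim: Reals_cases)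
  with z have "poly q r = 0" by (simp add: poly_map_poly_of_real)
  then obtain q' where q': "q = [:-r, 1:] * q'" by (auto simp: poly_eq_0_iff_dvd)
  with Suc.prems(1) have nz: "q' \<noteq> 0" by auto
  then have "d = degree q'" using Suc.hyps(2) q' by (simp add: degree_mult_eq del: mult_pCons_left)
  moreover have "z \<in> \<real>" if "poly (map_poly of_real q') z = 0" for z :: complex
    using Suc.prems(2)[of z] that unfolding q'
    by (simp add: map_poly_of_real_mult del: mult_pCons_left)
  ultimately have IH: "q' = smult (lead_coeff q') (\<Prod>r\<in>#proots q'. [:-r, 1:])"
    using Suc.hyps(1) nz by blast
  have "proots q = add_mset r (proots q')"
    using nz unfolding q' by (simp add: proots_mult del: mult_pCons_left)
  then have "smult (lead_coeff q) (\<Prod>r\<in>#proots q. [:-r, 1:])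
      = [:-r, 1:] * smult (lead_coeff q') (\<Prod>r\<in>#proots q'. [:-r, 1:])"
    unfolding q' lead_coeff_mult by (simp del: mult_pCons_left)
  also have "\<dots> = q" unfolding IH[symmetric] q' ..
  finally show ?case ..
qed

lemma hyperbolic_factorization:
  assumes "hyperbolic m p a"
  shows "size (eigenvalues p a x) = m"
    and "p (s *\<^sub>R a + x) = p a * (\<Prod>l\<in>#eigenvalues p a x. s + l)"
proof -
  define q r where "q = line_poly p a x" and "r = line_poly p x a"
  have p: "real_polynomial_function p" "p (t *\<^sub>R y) = t ^ m * p y" for t y
    using assms by (auto simp: hyperbolic_def homogeneous_polynomial_def)
  have r0: "coeff r 0 = p a"
    using poly_line_poly[OF p(1), of x a 0] by (simp add: r_def poly_0_coeff_0)
  have pa: "p a > 0" using assms by (simp add: hyperbolic_def)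
  have "poly (monom 1 (degree r) * q) s = poly (monom 1 m * reflect_poly r) s" if "s \<noteq> 0" for s
  proof -
    have "s *\<^sub>R a + x = s *\<^sub>R (inverse s *\<^sub>R x + a)"
      using that by (simp add: scaleR_right_distrib add.commute)
    then have "poly q s = s ^ m * poly r (inverse s)"
      by (simp add: q_def r_def poly_line_poly[OF p(1)] p(2))
    then show ?thesis using that by (simp add: poly_monom poly_reflect_poly_nz)
  qed
  then have "infinite {s. poly (monom 1 (degree r) * q - monom 1 m * reflect_poly r) s = 0}"
    by (intro infinite_super[OF _ infinite_UNIV_char_0[THEN Diff_infinite_finite[of "{0::real}", rotated]]]) auto
  then have eq: "monom 1 (degree r) * q = monom 1 m * reflect_poly r"
    using poly_roots_finite eq_iff_diff_eq_0 by blast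
  have dr: "degree (reflect_poly r) = degree r" and rn: "reflect_poly r \<noteq> 0"
    using r0 pa by (auto simp: degree_reflect_poly_eq)
  have qn: "q \<noteq> 0" using eq rn by auto
  have "degree r + degree q = m + degree r"
    using arg_cong[OF eq, of degree] qn rn dr
    by (simp add: degree_mult_eq degree_monom_eq)
  then have deg: "degree q = m" by simp
  have lc: "lead_coeff q = p a"
    using arg_cong[OF eq, of lead_coeff] dr r0 unfolding lead_coeff_mult
    by (simp add: degree_monom_eq coeff_reflect_poly)
  have "z \<in> \<real>" if "poly (map_poly of_real q) z = 0" for z :: complex
    using assms that unfolding q_def hyperbolic_def by blast
  from real_rooted_factorization[OF qn this]
  have fact: "q = smult (p a) (\<Prod>r\<in>#proots q. [:-r, 1:])"
    unfolding lc .
  have deg_prod: "degree (\<Prod>r\<in>#A. [:-r, 1:]) = size A \<and> (\<Prod>r\<in>#A. [:-r, 1:]) \<noteq> 0"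
    for A :: "real multiset"
    by (induction A) (simp_all add: degree_mult_eq del: mult_pCons_left)
  have "degree q = size (proots q)"
    using arg_cong[OF fact, of degree] pa
    by (simp add: deg_prod)
  then show "size (eigenvalues p a x) = m"
    using deg by (simp add: eigenvalues_def q_def)
  show "p (s *\<^sub>R a + x) = p a * (\<Prod>l\<in>#eigenvalues p a x. s + l)"
    using arg_cong[OF fact, of "\<lambda>q. poly q s"]
    by (simp add: eigenvalues_def q_def poly_line_poly[OF p(1)] poly_prod_mset
        image_mset.compositionality o_def)
qed

end

theory Submission
  imports Defs
begin

text \<open>
  On a line through \<open>1\<close> the inequality becomes one about real numbers: writing \<open>t\<close> for the
  mean of \<open>a\<close> and \<open>c\<close> for its rescaled distance to the diagonal, \<open>\<sigma>\<^sub>2(a) / binom(n,2) = t\<^sup>2 - c\<^sup>2\<close>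
  and the cone of \<open>\<sigma>\<^sub>2\<close> is \<open>{t > c}\<close>. Centrality says that the eigenvalues of \<open>a\<close> have mean \<open>t\<close>,
  and the inclusion of cones that they lie in \<open>[t - c, t + c]\<close>. As the logarithm lies above its
  chord on this interval, the geometric mean of the eigenvalues is at least
  \<open>sqrt ((t - c) (t + c))\<close>.
\<close>

section \<open>The polynomial \<open>sigma2\<close> in terms of mean and deviation\<close>

lemma sum_two_subsets:
  fixes f :: "'a \<Rightarrow> 'b::comm_ring_1"
  assumes "finite A"
  shows "2 * (\<Sum>S | S \<subseteq> A \<and> card S = 2. \<Prod>i\<in>S. f i) = (\<Sum>i\<in>A. f i)\<^sup>2 - (\<Sum>i\<in>A. (f i)\<^sup>2)"
  using assms
proof (induction A)
  case empty
  have "{S::'a set. S \<subseteq> {} \<and> card S = 2} = {}" by auto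
  then show ?case by (simp only: sum.empty) simp
next
  case (insert a A)
  \<comment> \<open>The pairs through the new element \<open>a\<close> supply the cross term of the
    expanded square.\<close>
  have split: "{S. S \<subseteq> insert a A \<and> card S = 2}
      = {S. S \<subseteq> A \<and> card S = 2} \<union> (\<lambda>i. {a, i}) ` A"
    using insert.hyps(2) by (auto simp: card_2_iff image_iff)
  have "inj_on (\<lambda>i. {a, i}) A"
    by (auto simp: inj_on_def doubleton_eq_iff)
  then have "(\<Sum>S\<in>(\<lambda>i. {a, i}) ` A. \<Prod>i\<in>S. f i) = (\<Sum>i\<in>A. \<Prod>j\<in>{a, i}. f j)"
    by (simp add: sum.reindex)
  also have "\<dots> = (\<Sum>i\<in>A. f a * f i)"
  proof (rule sum.cong)
    fix i assume "i \<in> A"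
    with insert.hyps(2) have "a \<noteq> i" by auto
    then show "(\<Prod>j\<in>{a, i}. f j) = f a * f i" by simp
  qed simp
  finally have "(\<Sum>S\<in>(\<lambda>i. {a, i}) ` A. \<Prod>i\<in>S. f i) = f a * (\<Sum>i\<in>A. f i)"
    by (simp add: sum_distrib_left)
  moreover have "(\<Sum>S | S \<subseteq> insert a A \<and> card S = 2. \<Prod>i\<in>S. f i)
      = (\<Sum>S | S \<subseteq> A \<and> card S = 2. \<Prod>i\<in>S. f i) + (\<Sum>S\<in>(\<lambda>i. {a, i}) ` A. \<Prod>i\<in>S. f i)"
    unfolding split using insert.hyps by (intro sum.union_disjoint) auto
  ultimately show ?case
    using insert by (simp add: algebra_simps power2_eq_square)
qed

definition mean :: "real ^ 'n \<Rightarrow> real" where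
  "mean x = (\<Sum>i\<in>UNIV. x $ i) / real CARD('n)"

text \<open>The scaling is chosen so that the Lorentz cone of \<open>sigma2\<close> has slope \<open>1\<close>.\<close>

definition deviation :: "real ^ 'n \<Rightarrow> real" where
  "deviation x = sqrt ((\<Sum>i\<in>UNIV. (x $ i - mean x)\<^sup>2) / (real CARD('n) * (real CARD('n) - 1)))"

lemma mean_affine: "mean (s *\<^sub>R 1 + r *\<^sub>R x) = s + r * mean x"
  by (simp add: mean_def sum.distrib sum_distrib_left[symmetric] add_divide_distrib)

lemma deviation_affine: "deviation (s *\<^sub>R 1 + r *\<^sub>R x) = \<bar>r\<bar> * deviation x"
proof -
  have "((s *\<^sub>R 1 + r *\<^sub>R x) $ i - mean (s *\<^sub>R 1 + r *\<^sub>R x))\<^sup>2 = r\<^sup>2 * (x $ i - mean x)\<^sup>2" for i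
    unfolding mean_affine by (simp add: power2_eq_square algebra_simps)
  then show ?thesis
    by (simp add: deviation_def sum_distrib_left[symmetric] real_sqrt_mult
        flip: times_divide_eq_right)
qed

lemma deviation_nonneg: "deviation (x :: real ^ 'n) \<ge> 0"
  by (simp add: deviation_def sum_nonneg)

text \<open>With \<open>T\<close> the sum and \<open>Q\<close> the sum of squares of the entries,
  \<open>2 * sigma2 x\<close> is \<open>T\<^sup>2 - Q\<close>, while the centred sum of squares in
  \<open>deviation\<close> is \<open>Q - T\<^sup>2 / n\<close>.\<close>

lemma sigma2_eq:
  fixes x :: "real ^ 'n"
  assumes "CARD('n) \<ge> 2"
  shows "sigma2 x = real (CARD('n) choose 2) * ((mean x)\<^sup>2 - (deviation x)\<^sup>2)"
proof -
  define n where "n = real CARD('n)"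
  define T where "T = (\<Sum>i\<in>UNIV. x $ i)"
  define Q where "Q = (\<Sum>i\<in>UNIV. (x $ i)\<^sup>2)"
  have n: "n \<ge> 2" using assms by (simp add: n_def)
  have choose: "real (CARD('n) choose 2) = n * (n - 1) / 2"
    using assms unfolding n_def choose_two
    by (subst real_of_nat_div) (simp_all add: of_nat_diff)
  have "(\<Sum>i\<in>UNIV. (x $ i - mean x)\<^sup>2) = Q - 2 * mean x * T + n * (mean x)\<^sup>2"
    by (simp add: power2_diff sum.distrib sum_subtractf Q_def T_def n_def
        sum_distrib_left[symmetric] sum_distrib_right[symmetric])
  also have "\<dots> = Q - T\<^sup>2 / n"
    using n by (simp add: mean_def n_def[symmetric] T_def[symmetric] field_simps power2_eq_square)
  finally have "(\<Sum>i\<in>UNIV. (x $ i - mean x)\<^sup>2) = Q - T\<^sup>2 / n" .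
  moreover have "(\<Sum>i\<in>UNIV. (x $ i - mean x)\<^sup>2) / (n * (n - 1)) \<ge> 0"
    using n by (intro divide_nonneg_nonneg sum_nonneg) auto
  ultimately have dev: "(deviation x)\<^sup>2 = (Q - T\<^sup>2 / n) / (n * (n - 1))"
    by (simp add: deviation_def n_def[symmetric])
  have "2 * sigma2 x = T\<^sup>2 - Q"
    using sum_two_subsets[of UNIV "\<lambda>i. x $ i"] by (simp add: sigma2_def T_def Q_def)
  moreover have "n * (n - 1) * ((mean x)\<^sup>2 - (deviation x)\<^sup>2) = T\<^sup>2 - Q"
    unfolding dev using n
    by (simp add: mean_def n_def[symmetric] T_def[symmetric] field_simps power2_eq_square)
  ultimately show ?thesis unfolding choose by simp
qed

lemma real_polynomial_function_sigma2: "real_polynomial_function (sigma2 :: real ^ 'n \<Rightarrow> real)"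
  unfolding sigma2_def
  by (intro real_polynomial_function_sum real_polynomial_function_prod
      real_polynomial_function.intros(1) bounded_linear_vec_nth) (auto intro: finite_subset)

text \<open>Adding \<open>s *\<^sub>R 1\<close> shifts the mean by \<open>s\<close> and keeps the
  deviation, so the eigenvalues of \<open>x\<close> are \<open>mean x - deviation x\<close> and
  \<open>mean x + deviation x\<close>; the smaller one decides.\<close>

lemma mem_garding_cone_sigma2_iff:
  fixes x :: "real ^ 'n"
  assumes "CARD('n) \<ge> 2"
  shows "x \<in> garding_cone sigma2 1 \<longleftrightarrow> deviation x < mean x"
proof -
  define q where "q = line_poly sigma2 1 x"
  define N where "N = real (CARD('n) choose 2)"
  have N: "N > 0" using assms by (simp add: N_def)
  have q: "poly q s = N * ((s + mean x - deviation x) * (s + mean x + deviation x))" for s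
    using mean_affine[of s 1 x] deviation_affine[of s 1 x]
    by (simp add: q_def poly_line_poly[OF real_polynomial_function_sigma2] sigma2_eq[OF assms]
        N_def power2_eq_square algebra_simps)
  \<comment> \<open>\<open>proots q\<close> has the roots of \<open>q\<close> as its elements only
    if \<open>q\<close> is nonzero. At this point the two linear factors are \<open>1\<close> and
    \<open>1 + 2 * deviation x\<close>.\<close>
  have "poly q (1 - mean x + deviation x) \<noteq> 0"
    unfolding q using N deviation_nonneg[of x] by simp
  then have "q \<noteq> 0" by auto
  then have "x \<in> garding_cone sigma2 1 \<longleftrightarrow> (\<forall>s. poly q s = 0 \<longrightarrow> s < 0)"
    by (auto simp: garding_cone_def eigenvalues_def q_def[symmetric])
  also have "\<dots> \<longleftrightarrow> deviation x < mean x"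
  proof
    assume *: "\<forall>s. poly q s = 0 \<longrightarrow> s < 0"
    have "poly q (deviation x - mean x) = 0" by (simp add: q)
    with * have "deviation x - mean x < 0" by blast
    then show "deviation x < mean x" by simp
  next
    assume "deviation x < mean x"
    then show "\<forall>s. poly q s = 0 \<longrightarrow> s < 0"
      using N deviation_nonneg[of x] by (auto simp: q)
  qed
  finally show ?thesis .
qed

section \<open>Eigenvalues: their sum and the interval containing them\<close>

lemma hyperbolic_pos_on_garding_cone:
  assumes "hyperbolic m p a" "x \<in> garding_cone p a"
  shows "p x > 0"
proof -
  have "(\<Prod>l\<in>#L. l) > 0" if "\<forall>l\<in>#L. l > 0" for L :: "real multiset"
    using that by (induction L) auto
  then show ?thesis
    using hyperbolic_factorization(2)[OF assms(1), of 0 x] assms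
    by (simp add: garding_cone_def hyperbolic_def)
qed

lemma hyperbolic_eigenvalue_root:
  assumes "hyperbolic m p a" "l \<in># eigenvalues p a x"
  shows "p (x - l *\<^sub>R a) = 0"
proof -
  have "(\<Prod>k\<in>#eigenvalues p a x. k - l) = 0"
    using assms(2) by (auto simp: prod_mset_zero_iff)
  then show ?thesis
    using hyperbolic_factorization(2)[OF assms(1), of "- l" x] by simp
qed

lemma hyp_trace_self:
  assumes "hyperbolic m p a"
  shows "hyp_trace p a a = real m"
proof -
  have "l = 1" if "l \<in># eigenvalues p a a" for l
  proof -
    have "p ((1 - l) *\<^sub>R a) = 0"
      using hyperbolic_eigenvalue_root[OF assms that] by (simp add: scaleR_left_diff_distrib)
    then show ?thesis
      using assms by (simp add: hyperbolic_def homogeneous_polynomial_def)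
  qed
  then have "eigenvalues p a a = replicate_mset m 1"
    using hyperbolic_factorization(1)[OF assms, of a] by (metis set_mset_subset_singletonD subsetI singletonI)
  then show ?thesis by (simp add: hyp_trace_def)
qed

text \<open>Evaluating the trace condition at \<open>1\<close>, whose eigenvalues are all
  \<open>1\<close>, determines the constant as \<open>m / n\<close>, where \<open>n\<close> is the
  dimension.\<close>

lemma central_hyperbolic_trace:
  fixes p :: "real ^ 'n \<Rightarrow> real"
  assumes "central_hyperbolic m p"
  shows "hyp_trace p 1 x = real m * mean x"
proof -
  obtain \<kappa> where \<kappa>: "\<And>x. hyp_trace p 1 x = \<kappa> * (\<Sum>i\<in>UNIV. x $ i)"
    using assms by (auto simp: central_hyperbolic_def)
  have "real m = \<kappa> * real CARD('n)"
    using hyp_trace_self[of m p 1] \<kappa>[of 1] assms by (simp add: central_hyperbolic_def)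
  then show ?thesis by (simp add: \<kappa> mean_def)
qed

text \<open>Since \<open>p\<close> vanishes at \<open>x - l *\<^sub>R 1\<close> and, by homogeneity,
  at its negative, neither lies in the cone of \<open>sigma2\<close>, where \<open>p\<close> is
  positive. Both vectors have the deviation of \<open>x\<close>, and their means are
  \<open>mean x - l\<close> and \<open>l - mean x\<close>.\<close>

lemma eigenvalue_bounds:
  fixes p :: "real ^ 'n \<Rightarrow> real"
  assumes "CARD('n) \<ge> 2" "hyperbolic m p 1"
    and "garding_cone sigma2 1 \<subseteq> garding_cone p 1"
    and l: "l \<in># eigenvalues p 1 x"
  shows "\<bar>l - mean x\<bar> \<le> deviation x"
proof -
  have nz: "p y \<noteq> 0" if "deviation y < mean y" for y
    using that hyperbolic_pos_on_garding_cone[OF assms(2), of y] assms(3)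
      mem_garding_cone_sigma2_iff[OF assms(1), of y] by auto
  have root: "p (x - l *\<^sub>R 1) = 0"
    by (rule hyperbolic_eigenvalue_root[OF assms(2) l])
  moreover have "p (r *\<^sub>R (x - l *\<^sub>R 1)) = r ^ m * p (x - l *\<^sub>R 1)" for r
    using assms(2) by (simp only: hyperbolic_def homogeneous_polynomial_def)
  ultimately have "p ((- r * l) *\<^sub>R 1 + r *\<^sub>R x) = 0" for r
    by (simp add: scaleR_right_diff_distrib)
  then have "mean ((- r * l) *\<^sub>R 1 + r *\<^sub>R x) \<le> deviation ((- r * l) *\<^sub>R 1 + r *\<^sub>R x)" for r
    using nz by (meson not_le)
  from this[of 1] this[of "- 1"] show ?thesis
    by (simp only: mean_affine deviation_affine)
qed

section \<open>A lower bound for products of reals with given mean and range\<close>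

text \<open>The left side is the chord of \<open>ln\<close> over the interval from
  \<open>t - c\<close> to \<open>t + c\<close>, expanded about the midpoint so that its linear part
  cancels when summed over numbers of mean \<open>t\<close>. For \<open>c = 0\<close> the slope is a
  division by zero, but then \<open>l = t\<close>.\<close>

lemma ln_ge_chord:
  fixes t c l :: real
  assumes "c < t" "\<bar>l - t\<bar> \<le> c"
  shows "(ln (t + c) + ln (t - c)) / 2 + (ln (t + c) - ln (t - c)) / (2 * c) * (l - t) \<le> ln l"
proof (cases "c = 0")
  case False
  \<comment> \<open>The barycentric coordinate of \<open>l\<close> between \<open>t - c\<close> and
    \<open>t + c\<close>.\<close>
  define u where "u = (l - t + c) / (2 * c)"
  have c: "c > 0" using assms False by linarith
  have u: "0 \<le> u" "u \<le> 1" using c assms by (auto simp: u_def field_simps)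
  have l: "(1 - u) * (t - c) + u * (t + c) = l"
    using c by (simp add: u_def field_simps)
  have "(1 - u) * ln (t - c) + u * ln (t + c) \<le> ln ((1 - u) * (t - c) + u * (t + c))"
    using concave_onD[OF ln_concave, of u "t - c" "t + c"] u c assms by simp
  moreover have "(1 - u) * ln (t - c) + u * ln (t + c)
      = (ln (t + c) + ln (t - c)) / 2 + (ln (t + c) - ln (t - c)) / (2 * c) * (l - t)"
    using c by (simp add: u_def field_simps)
  ultimately show ?thesis unfolding l by simp
qed (use assms in simp)

lemma prod_mset_ge_of_mean:
  fixes L :: "real multiset" and t c :: real
  assumes "c < t" and bd: "\<And>l. l \<in># L \<Longrightarrow> \<bar>l - t\<bar> \<le> c"
    and "sum_mset L = real (size L) * t"
  shows "sqrt (t\<^sup>2 - c\<^sup>2) ^ size L \<le> prod_mset L"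
proof (cases "L = {#}")
  case False
  then obtain l0 where "l0 \<in># L" by blast
  with bd have c: "0 \<le> c" by fastforce
  define A where "A = (ln (t + c) + ln (t - c)) / 2"
  define k where "k = (ln (t + c) - ln (t - c)) / (2 * c)"
  \<comment> \<open>The mean is known only for \<open>L\<close> itself, so the induction over
    submultisets carries the linear term along; it vanishes at \<open>M = L\<close>. Positivity is
    carried too, to split the logarithm of a product.\<close>
  have "0 < prod_mset M \<and>
      real (size M) * A + k * (sum_mset M - real (size M) * t) \<le> ln (prod_mset M)"
    if "M \<subseteq># L" for M
    using that
  proof (induction M)
    case (add l M)
    then have "l \<in># L" "M \<subseteq># L" by (auto dest: mset_subset_eq_insertD subset_mset.less_imp_le)
    moreover have "l > 0" using bd[OF \<open>l \<in># L\<close>] assms(1) by linarith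
    moreover have "A + k * (l - t) \<le> ln l"
      using ln_ge_chord[OF assms(1) bd[OF \<open>l \<in># L\<close>]] by (simp add: A_def k_def)
    moreover have "prod_mset M > 0" using add.IH \<open>M \<subseteq># L\<close> by blast
    ultimately show ?case
      using add.IH by (simp add: ln_mult_pos) (simp add: algebra_simps)
  qed simp
  from this[of L] have pos: "0 < prod_mset L" and le: "real (size L) * A \<le> ln (prod_mset L)"
    using assms(3) by auto
  have "ln (t + c) + ln (t - c) = ln (t\<^sup>2 - c\<^sup>2)"
    using c assms(1) by (subst ln_mult_pos[symmetric]) (simp_all add: power2_eq_square algebra_simps)
  moreover have tc: "0 < t\<^sup>2 - c\<^sup>2"
    using c assms(1) by (simp add: power_strict_mono)
  ultimately have "A = ln (sqrt (t\<^sup>2 - c\<^sup>2))"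
    by (simp add: A_def ln_sqrt)
  with le tc have "ln (sqrt (t\<^sup>2 - c\<^sup>2) ^ size L) \<le> ln (prod_mset L)"
    by (simp add: ln_realpow)
  with pos tc show ?thesis by (subst (asm) ln_le_cancel_iff) auto
qed simp

theorem corollary1p3:
  fixes p :: "real ^ 'n \<Rightarrow> real" and m :: nat
  assumes "CARD('n) \<ge> 2"
    and "central_hyperbolic m p"
    and "garding_cone sigma2 1 \<subseteq> garding_cone p 1"
  shows "\<forall>a \<in> garding_cone sigma2 1.
           root m (p a) \<ge> root m (p 1) * sqrt (sigma2 a / real (CARD('n) choose 2))"
proof
  fix a :: "real ^ 'n"
  assume "a \<in> garding_cone sigma2 1"
  then have dev: "deviation a < mean a"
    by (simp add: mem_garding_cone_sigma2_iff[OF assms(1)])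
  have hyp: "hyperbolic m p 1" using assms(2) by (simp add: central_hyperbolic_def)
  then have m: "m > 0" and p1: "p 1 > 0" by (auto simp: hyperbolic_def)
  define L where "L = eigenvalues p 1 a"
  define d where "d = (mean a)\<^sup>2 - (deviation a)\<^sup>2"
  have size: "size L = m" unfolding L_def by (rule hyperbolic_factorization(1)[OF hyp])
  have pa: "p a = p 1 * prod_mset L"
    using hyperbolic_factorization(2)[OF hyp, of 0 a] by (simp add: L_def)
  have "sum_mset L = real m * mean a"
    using central_hyperbolic_trace[OF assms(2), of a] by (simp add: hyp_trace_def L_def)
  then have "sqrt d ^ m \<le> prod_mset L"
    using prod_mset_ge_of_mean[OF dev, of L] eigenvalue_bounds[OF assms(1) hyp assms(3)]
    by (simp add: L_def[symmetric] size d_def)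
  then have "root m (sqrt d ^ m) \<le> root m (prod_mset L)"
    using m by simp
  \<comment> \<open>Nonnegativity of \<open>sqrt d\<close> is what lets \<open>root m\<close> cancel
    the power.\<close>
  moreover have "d \<ge> 0"
    unfolding d_def using dev deviation_nonneg[of a] by (simp add: power_mono)
  ultimately have "sqrt d \<le> root m (prod_mset L)"
    using m by (simp add: real_root_power_cancel)
  moreover have "sigma2 a / real (CARD('n) choose 2) = d"
    using assms(1) by (simp add: sigma2_eq d_def)
  ultimately show "root m (p a) \<ge> root m (p 1) * sqrt (sigma2 a / real (CARD('n) choose 2))"
    using p1 m by (simp add: pa real_root_mult mult_left_mono)
qed

end
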